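(* Suppose that $(X,\tau,<)$ is a GO-space. If $X$ is monotonically metacompact, then $X$ has a monotone open locally-finite operator.
   Context: A GO-space (generalized ordered space) $(X,\tau,<)$ is a linearly ordered set $(X,<)$ with a Hausdorff topology $\tau$ having a base of order-convex sets. A family $\mathcal A$ of subsets of $X$ refines a family $\mathcal B$ if every $A\in\mathcal A$ is contained in some $B\in\mathcal B$. $X$ is monotonically metacompact if there is a function $r$ assigning to each open cover $\mathcal U$ of $X$ a point-finite open refinement $r(\mathcal U)$ of $\mathcal U$ covering $X$, such that whenever $\mathcal U,\mathcal V$ are open covers of $X$ and $\mathcal U$ refines $\mathcal V$, then $r(\mathcal U)$ refines $r(\mathcal V)$. A monotone open locally-finite operator is a function $r$ assigning to each open cover $\mathcal U$ of $X$ an open cover $r(\mathcal U)$ of $X$ which is a locally-finite refinement of $\mathcal U$, such that whenever $\mathcal U,\mathcal V$ are open covers and $\mathcal U$ refines $\mathcal V$, then $r(\mathcal U)$ refines $r(\mathcal V)$. *)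

theory Defs
  imports "HOL-Analysis.Analysis"
begin

text \<open>
  The linearly ordered set underlying a GO-space is the carrier \<open>topspace X\<close>, which may be any
  subset (possibly empty or all) of a linearly ordered type, with the induced order.
\<close>

definition order_convex_in :: "'a::linorder set \<Rightarrow> 'a set \<Rightarrow> bool" where
  "order_convex_in S C \<longleftrightarrow>
     C \<subseteq> S \<and> (\<forall>x\<in>C. \<forall>y\<in>C. \<forall>z\<in>S. x < z \<and> z < y \<longrightarrow> z \<in> C)"

definition topology_base :: "'a topology \<Rightarrow> 'a set set \<Rightarrow> bool" where
  "topology_base X \<B> \<longleftrightarrow> openin X = arbitrary union_of (\<lambda>B. B \<in> \<B>)"

definition GO_space :: "'a::linorder topology \<Rightarrow> bool" where
  "GO_space X \<longleftrightarrow>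
     Hausdorff_space X \<and>
     (\<exists>\<B>. topology_base X \<B> \<and> (\<forall>B\<in>\<B>. order_convex_in (topspace X) B))"

definition refines :: "'a set set \<Rightarrow> 'a set set \<Rightarrow> bool" where
  "refines \<A> \<B> \<longleftrightarrow> (\<forall>A\<in>\<A>. \<exists>B\<in>\<B>. A \<subseteq> B)"

definition open_cover :: "'a topology \<Rightarrow> 'a set set \<Rightarrow> bool" where
  "open_cover X \<U> \<longleftrightarrow> (\<forall>U\<in>\<U>. openin X U) \<and> \<Union>\<U> = topspace X"

definition point_finite_in :: "'a topology \<Rightarrow> 'a set set \<Rightarrow> bool" where
  "point_finite_in X \<A> \<longleftrightarrow> (\<forall>x\<in>topspace X. finite {A \<in> \<A>. x \<in> A})"

definition monotone_cover_operator ::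
    "'a topology \<Rightarrow> ('a set set \<Rightarrow> 'a set set) \<Rightarrow> bool" where
  "monotone_cover_operator X r \<longleftrightarrow>
     (\<forall>\<U> \<V>. open_cover X \<U> \<and> open_cover X \<V> \<and> refines \<U> \<V> \<longrightarrow> refines (r \<U>) (r \<V>))"

definition monotonically_metacompact :: "'a topology \<Rightarrow> bool" where
  "monotonically_metacompact X \<longleftrightarrow>
     (\<exists>r. (\<forall>\<U>. open_cover X \<U> \<longrightarrow>
               open_cover X (r \<U>) \<and> refines (r \<U>) \<U> \<and> point_finite_in X (r \<U>)) \<and>
          monotone_cover_operator X r)"

definition monotone_open_locally_finite_operator ::
    "'a topology \<Rightarrow> ('a set set \<Rightarrow> 'a set set) \<Rightarrow> bool" where
  "monotone_open_locally_finite_operator X r \<longleftrightarrow>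
     (\<forall>\<U>. open_cover X \<U> \<longrightarrow>
         open_cover X (r \<U>) \<and> refines (r \<U>) \<U> \<and> locally_finite_in X (r \<U>)) \<and>
     monotone_cover_operator X r"

end

theory Submission
  imports Defs
begin

text \<open>
  Let \<open>r\<close> be a monotone point-finite operator. Replacing the members of \<open>r \<U>\<close> by their convex
  components and then keeping only the inclusion-maximal ones preserves point-finiteness,
  covering and monotonicity. A point-finite antichain of convex sets is automatically locally
  finite: if \<open>A\<close> and \<open>B\<^sub>0\<close> belong to it and \<open>B\<^sub>0\<close> contains \<open>b \<in> A\<close> and a point \<open>c\<close> to the left of
  \<open>A\<close>, then every other member that meets \<open>A\<close> and protrudes from it on the left must contain
  \<open>b\<close> or \<open>c\<close>, since otherwise it would lie between them and hence inside \<open>B\<^sub>0\<close>. The same holds on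
  the right, so \<open>A\<close> meets only finitely many members.
\<close>

text \<open>The base point \<open>x\<close> is meant to lie in \<open>A\<close>. Writing the
  interval with \<open>min\<close> and \<open>max\<close> treats both sides of \<open>x\<close>
  alike, and intersecting it with \<open>S\<close> makes convexity relative to a carrier that may
  omit points of the ambient type.\<close>

definition convex_component :: "'a::linorder set \<Rightarrow> 'a set \<Rightarrow> 'a \<Rightarrow> 'a set" where
  "convex_component S A x = {y \<in> A. {min x y..max x y} \<inter> S \<subseteq> A}"

text \<open>Each component is based at a point of its own set, so the empty set never occurs, even
  if it belongs to \<open>\<A>\<close>.\<close>

definition convex_components :: "'a::linorder set \<Rightarrow> 'a set set \<Rightarrow> 'a set set" where
  "convex_components S \<A> = {convex_component S A x | A x. A \<in> \<A> \<and> x \<in> A}"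

definition maximal_members :: "'a set set \<Rightarrow> 'a set set" where
  "maximal_members \<A> = {A \<in> \<A>. \<forall>B\<in>\<A>. A \<subseteq> B \<longrightarrow> A = B}"

lemma refines_trans: "refines \<A> \<B> \<Longrightarrow> refines \<B> \<C> \<Longrightarrow> refines \<A> \<C>"
  unfolding refines_def by (meson subset_trans)

lemma refines_subset: "\<A> \<subseteq> \<B> \<Longrightarrow> refines \<A> \<B>"
  unfolding refines_def by blast

lemma order_convex_inD:
  "order_convex_in S C \<Longrightarrow> x \<in> C \<Longrightarrow> y \<in> C \<Longrightarrow> z \<in> S \<Longrightarrow> x < z \<Longrightarrow> z < y \<Longrightarrow> z \<in> C"
  unfolding order_convex_in_def by (elim conjE) (meson bspec)

section \<open>Convex components of a single set\<close>

lemma convex_component_subset: "convex_component S A x \<subseteq> A"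
  by (auto simp: convex_component_def)

lemma convex_component_mono: "A \<subseteq> B \<Longrightarrow> convex_component S A x \<subseteq> convex_component S B x"
  by (auto simp: convex_component_def)

lemma convex_component_self: "x \<in> A \<Longrightarrow> x \<in> convex_component S A x"
  by (auto simp: convex_component_def)

text \<open>Absorption principle behind the openness and uniqueness of components: a point between
  \<open>x\<close> and \<open>z\<close> lies either between \<open>x\<close> and \<open>y\<close>,
  hence in \<open>A\<close> by the choice of \<open>y\<close>, or between \<open>y\<close> and
  \<open>z\<close>, hence in the convex set \<open>B\<close>.\<close>

lemma convex_component_extend:
  assumes "y \<in> convex_component S A x" "B \<subseteq> A" "order_convex_in S B" "y \<in> B"
  shows "B \<subseteq> convex_component S A x"
proof
  fix z assume z: "z \<in> B"
  have "w \<in> A" if "w \<in> {min x z..max x z}" "w \<in> S" for w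
  proof (cases "w \<in> {min x y..max x y}")
    case True
    then show ?thesis using assms(1) that(2) by (auto simp: convex_component_def)
  next
    case False
    \<comment> \<open>The value \<open>w = y\<close> belongs to the previous case;
      \<open>w = z\<close> is listed apart because \<open>order_convex_in\<close> only speaks of
      points strictly between two members.\<close>
    then have "w = z \<or> y < w \<and> w < z \<or> z < w \<and> w < y"
      using that(1) by (auto simp: min_def max_def split: if_splits)
    then have "w \<in> B"
      using order_convex_inD[OF assms(3)] assms(4) z that(2) by blast
    then show ?thesis
      using assms(2) by blast
  qed
  then show "z \<in> convex_component S A x"
    using z assms(2) by (auto simp: convex_component_def)
qed

lemma order_convex_convex_component:
  assumes "A \<subseteq> S"
  shows "order_convex_in S (convex_component S A x)"
  unfolding order_convex_in_def
proof (intro conjI ballI impI)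
  show "convex_component S A x \<subseteq> S"
    using assms convex_component_subset[of S A x] by blast
next
  fix u v z
  assume uv: "u \<in> convex_component S A x" "v \<in> convex_component S A x"
    and z: "z \<in> S" "u < z \<and> z < v"
  \<comment> \<open>If \<open>x \<le> z\<close>, the interval lies in the one between
    \<open>x\<close> and \<open>v\<close>; otherwise it lies in the one between \<open>x\<close> and
    \<open>u\<close>.\<close>
  have "{min x z..max x z} \<subseteq> {min x u..max x u} \<union> {min x v..max x v}"
    using z(2) by (auto simp: min_def max_def)
  moreover have "z \<in> {min x z..max x z} \<inter> S"
    using z(1) by simp
  ultimately show "z \<in> convex_component S A x"
    using uv unfolding convex_component_def by blast
qed

text \<open>Both components are convex subsets of \<open>A\<close> containing \<open>y\<close>, so
  each absorbs the other by \<open>convex_component_extend\<close>.\<close>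

lemma convex_component_eq:
  assumes "A \<subseteq> S" "x \<in> A" "y \<in> convex_component S A x"
  shows "convex_component S A x = convex_component S A y"
proof
  have "y \<in> A"
    using assms(3) convex_component_subset[of S A x] by blast
  then show "convex_component S A x \<subseteq> convex_component S A y"
    using assms
    by (intro convex_component_extend[where y = y])
      (auto simp: convex_component_self convex_component_subset order_convex_convex_component)
  show "convex_component S A y \<subseteq> convex_component S A x"
    using assms \<open>y \<in> A\<close>
    by (intro convex_component_extend[where y = y])
      (auto simp: convex_component_self convex_component_subset order_convex_convex_component)
qed

lemma GO_space_convex_neighbourhood:
  assumes "GO_space X" "openin X U" "x \<in> U"
  obtains B where "openin X B" "order_convex_in (topspace X) B" "x \<in> B" "B \<subseteq> U"
proof -
  obtain \<B> where base: "openin X = arbitrary union_of (\<lambda>B. B \<in> \<B>)"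
    and conv: "\<forall>B\<in>\<B>. order_convex_in (topspace X) B"
    using assms(1) unfolding GO_space_def topology_base_def by blast
  obtain B where "B \<in> \<B>" "x \<in> B" "B \<subseteq> U"
    using base assms(2,3) by (auto simp: arbitrary_union_of_alt)
  moreover have "openin X B"
    unfolding base using \<open>B \<in> \<B>\<close> by (simp add: arbitrary_union_of_inc)
  ultimately show ?thesis
    using conv that by blast
qed

text \<open>The convex base enters here: around each point of the component there is an open convex
  set inside \<open>A\<close>, and the component absorbs it.\<close>

lemma openin_convex_component:
  assumes "GO_space X" "openin X A"
  shows "openin X (convex_component (topspace X) A x)"
proof (subst openin_subopen, intro ballI)
  fix y assume y: "y \<in> convex_component (topspace X) A x"
  then have "y \<in> A"
    using convex_component_subset[of _ A x] by blast
  then obtain B where B: "openin X B" "order_convex_in (topspace X) B" "y \<in> B" "B \<subseteq> A"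
    by (rule GO_space_convex_neighbourhood[OF assms])
  then have "B \<subseteq> convex_component (topspace X) A x"
    using convex_component_extend[OF y] by simp
  with B show "\<exists>T. openin X T \<and> y \<in> T \<and> T \<subseteq> convex_component (topspace X) A x"
    by auto
qed

section \<open>Passing from a cover to its convex components\<close>

lemma refines_convex_components: "refines (convex_components S \<A>) \<A>"
  unfolding refines_def
proof
  fix C assume "C \<in> convex_components S \<A>"
  then obtain A x where "A \<in> \<A>" "C = convex_component S A x"
    unfolding convex_components_def by blast
  then show "\<exists>B\<in>\<A>. C \<subseteq> B"
    using convex_component_subset[of S A x] by auto
qed

lemma open_cover_convex_components:
  assumes "GO_space X" "open_cover X \<A>"
  shows "open_cover X (convex_components (topspace X) \<A>)"
proof -
  have "\<Union>(convex_components (topspace X) \<A>) = \<Union>\<A>"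
  proof
    show "\<Union>(convex_components (topspace X) \<A>) \<subseteq> \<Union>\<A>"
      using refines_convex_components[of "topspace X" \<A>] unfolding refines_def by blast
    show "\<Union>\<A> \<subseteq> \<Union>(convex_components (topspace X) \<A>)"
      unfolding convex_components_def by (auto intro: convex_component_self)
  qed
  moreover have "openin X C" if C: "C \<in> convex_components (topspace X) \<A>" for C
  proof -
    obtain A x where "A \<in> \<A>" "C = convex_component (topspace X) A x"
      using C unfolding convex_components_def by blast
    then show ?thesis
      using assms(2) openin_convex_component[OF assms(1), of A x] by (simp add: open_cover_def)
  qed
  ultimately show ?thesis
    using assms(2) unfolding open_cover_def by simp
qed

text \<open>Enlarging the set while keeping the base point enlarges the component.\<close>

lemma convex_components_mono:
  assumes "refines \<A> \<B>"
  shows "refines (convex_components S \<A>) (convex_components S \<B>)"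
  unfolding refines_def
proof
  fix C assume "C \<in> convex_components S \<A>"
  then obtain A x where A: "A \<in> \<A>" "x \<in> A" and C: "C = convex_component S A x"
    unfolding convex_components_def by blast
  obtain B where B: "B \<in> \<B>" "A \<subseteq> B"
    using assms A(1) unfolding refines_def by blast
  have "convex_component S B x \<in> convex_components S \<B>"
    using A(2) B unfolding convex_components_def by blast
  then show "\<exists>D\<in>convex_components S \<B>. C \<subseteq> D"
    using convex_component_mono[OF B(2)] C by blast
qed

text \<open>A component through \<open>p\<close> can be rebased at \<open>p\<close>, so each of the
  finitely many members through \<open>p\<close> contributes only one.\<close>

lemma point_finite_convex_components:
  assumes "\<Union>\<A> \<subseteq> topspace X" "point_finite_in X \<A>"
  shows "point_finite_in X (convex_components (topspace X) \<A>)"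
  unfolding point_finite_in_def
proof
  fix p assume "p \<in> topspace X"
  then have "finite ((\<lambda>A. convex_component (topspace X) A p) ` {A \<in> \<A>. p \<in> A})"
    using assms(2) unfolding point_finite_in_def by blast
  moreover have "{C \<in> convex_components (topspace X) \<A>. p \<in> C}
      \<subseteq> (\<lambda>A. convex_component (topspace X) A p) ` {A \<in> \<A>. p \<in> A}"
  proof
    fix C assume "C \<in> {C \<in> convex_components (topspace X) \<A>. p \<in> C}"
    then obtain A x where A: "A \<in> \<A>" "x \<in> A" "p \<in> C" and C: "C = convex_component (topspace X) A x"
      unfolding convex_components_def by blast
    have "C = convex_component (topspace X) A p"
      using A C assms(1) convex_component_eq[of A "topspace X" x p] by blast
    moreover have "p \<in> A"
      using A(3) C convex_component_subset[of _ A x] by blast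
    ultimately show "C \<in> (\<lambda>A. convex_component (topspace X) A p) ` {A \<in> \<A>. p \<in> A}"
      using A(1) by blast
  qed
  ultimately show "finite {C \<in> convex_components (topspace X) \<A>. p \<in> C}"
    by (rule rev_finite_subset)
qed

lemma convex_components_convex:
  "\<Union>\<A> \<subseteq> S \<Longrightarrow> C \<in> convex_components S \<A> \<Longrightarrow> order_convex_in S C"
  unfolding convex_components_def using order_convex_convex_component by blast

lemma convex_components_nonempty: "C \<in> convex_components S \<A> \<Longrightarrow> C \<noteq> {}"
  unfolding convex_components_def using convex_component_self by blast

section \<open>Inclusion-maximal members\<close>

lemma maximal_members_subset: "maximal_members \<A> \<subseteq> \<A>"
  by (auto simp: maximal_members_def)

text \<open>All supersets of a nonempty \<open>A\<close> share a chosen point of \<open>A\<close>,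
  so point-finiteness leaves finitely many of them, and one that is maximal among the members
  through that point is maximal in the whole family.\<close>

lemma refines_maximal_members:
  assumes "point_finite_in X \<A>" "\<Union>\<A> \<subseteq> topspace X" "{} \<notin> \<A>"
  shows "refines \<A> (maximal_members \<A>)"
  unfolding refines_def
proof
  fix A assume A: "A \<in> \<A>"
  then have "A \<noteq> {}" "A \<subseteq> topspace X"
    using assms(2,3) by auto
  then obtain x where x: "x \<in> A" "x \<in> topspace X"
    by blast
  have "finite {B \<in> \<A>. x \<in> B}"
    using assms(1) x(2) unfolding point_finite_in_def by blast
  then obtain M where M: "M \<in> {B \<in> \<A>. x \<in> B}" "A \<subseteq> M"
      "\<forall>B\<in>{B \<in> \<A>. x \<in> B}. M \<subseteq> B \<longrightarrow> B = M"
    using finite_has_maximal2[of "{B \<in> \<A>. x \<in> B}" A] A x(1) by auto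
  then have "M \<in> maximal_members \<A>"
    unfolding maximal_members_def by blast
  then show "\<exists>B\<in>maximal_members \<A>. A \<subseteq> B"
    using M(2) by blast
qed

section \<open>Local finiteness of convex antichains\<close>

text \<open>Since \<open>R\<close> is the order or its reverse, one argument handles protrusion on
  either side.\<close>

lemma finite_protruding:
  fixes X :: "'a::linorder topology"
  assumes pf: "point_finite_in X \<A>"
    and conv: "\<And>B. B \<in> \<A> \<Longrightarrow> order_convex_in (topspace X) B"
    and anti: "\<And>B C. B \<in> \<A> \<Longrightarrow> C \<in> \<A> \<Longrightarrow> B \<subseteq> C \<Longrightarrow> B = C"
    and R: "R = (<) \<or> R = (>)"
  shows "finite {B \<in> \<A>. B \<inter> A \<noteq> {} \<and> (\<exists>c\<in>B. \<forall>a\<in>A. R c a)}" (is "finite ?L")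
proof (cases "?L = {}")
  case False
  then obtain B\<^sub>0 b c where B0: "B\<^sub>0 \<in> \<A>" "b \<in> B\<^sub>0" "b \<in> A" "c \<in> B\<^sub>0" "\<forall>a\<in>A. R c a"
    by blast
  have sub: "B \<subseteq> topspace X" if "B \<in> \<A>" for B
    using conv[OF that] by (simp add: order_convex_in_def)
  have between: "w \<in> B"
    if "B \<in> \<A>" "u \<in> B" "v \<in> B" "w \<in> topspace X" "R u w" "R w v" for B u v w
    using R
  proof
    assume "R = (<)"
    then show ?thesis
      using order_convex_inD[OF conv[OF that(1)] that(2,3,4)] that(5,6) by simp
  next
    assume "R = (>)"
    then show ?thesis
      using order_convex_inD[OF conv[OF that(1)] that(3,2,4)] that(5,6) by simp
  qed
  have total: "R u v \<or> R v u" if "u \<noteq> v" for u v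
    using R that by auto
  have S: "b \<in> topspace X" "c \<in> topspace X"
    using B0 sub by blast+
  have "?L \<subseteq> insert B\<^sub>0 ({B \<in> \<A>. b \<in> B} \<union> {B \<in> \<A>. c \<in> B})"
  proof
    fix B assume "B \<in> ?L"
    then obtain b' c' where B: "B \<in> \<A>" "b' \<in> B" "b' \<in> A" "c' \<in> B" "\<forall>a\<in>A. R c' a"
      by blast
    have "B = B\<^sub>0" if "b \<notin> B" "c \<notin> B"
    proof (rule anti[OF B(1) B0(1)], rule subsetI)
      fix z assume z: "z \<in> B"
      then have neq: "z \<noteq> b" "z \<noteq> c"
        using that by auto
      \<comment> \<open>Otherwise \<open>b\<close> would lie between \<open>c'\<close> and
        \<open>z\<close>, both in \<open>B\<close>. Likewise, \<open>R z c\<close> below would put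
        \<open>c\<close> between \<open>z\<close> and \<open>b'\<close>.\<close>
      have "\<not> R b z"
        using between[OF B(1,4) z S(1)] B(5) B0(3) that(1) by blast
      then have "R z b"
        using total[OF neq(1)] by blast
      have "\<not> R z c"
        using between[OF B(1) z B(2) S(2)] B(3) B0(5) that(2) by blast
      then have "R c z"
        using total[OF neq(2)] by blast
      then show "z \<in> B\<^sub>0"
        using between[OF B0(1,4,2)] \<open>R z b\<close> z sub[OF B(1)] by blast
    qed
    then show "B \<in> insert B\<^sub>0 ({B \<in> \<A>. b \<in> B} \<union> {B \<in> \<A>. c \<in> B})"
      using B(1) by blast
  qed
  moreover have "finite (insert B\<^sub>0 ({B \<in> \<A>. b \<in> B} \<union> {B \<in> \<A>. c \<in> B}))"
    using pf S by (simp add: point_finite_in_def)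
  ultimately show ?thesis
    by (rule finite_subset)
qed (simp only: finite.emptyI)

text \<open>A member \<open>A\<close> containing \<open>x\<close> is itself the required
  neighbourhood: any member meeting it equals \<open>A\<close> or protrudes from it on some
  side.\<close>

lemma locally_finite_convex_antichain:
  assumes cover: "open_cover X \<A>"
    and pf: "point_finite_in X \<A>"
    and conv: "\<And>B. B \<in> \<A> \<Longrightarrow> order_convex_in (topspace X) B"
    and anti: "\<And>B C. B \<in> \<A> \<Longrightarrow> C \<in> \<A> \<Longrightarrow> B \<subseteq> C \<Longrightarrow> B = C"
  shows "locally_finite_in X \<A>"
  unfolding locally_finite_in_def
proof (intro conjI ballI)
  show "\<Union>\<A> \<subseteq> topspace X"
    using cover by (simp add: open_cover_def)
next
  fix x assume "x \<in> topspace X"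
  then obtain A where A: "A \<in> \<A>" "x \<in> A"
    using cover unfolding open_cover_def by blast
  let ?L = "{B \<in> \<A>. B \<inter> A \<noteq> {} \<and> (\<exists>c\<in>B. \<forall>a\<in>A. c < a)}"
  let ?R = "{B \<in> \<A>. B \<inter> A \<noteq> {} \<and> (\<exists>c\<in>B. \<forall>a\<in>A. a < c)}"
  have "{B \<in> \<A>. B \<inter> A \<noteq> {}} \<subseteq> insert A (?L \<union> ?R)"
  proof
    fix B assume B: "B \<in> {B \<in> \<A>. B \<inter> A \<noteq> {}}"
    show "B \<in> insert A (?L \<union> ?R)"
    proof (cases "B \<subseteq> A")
      case True
      then show ?thesis using anti A(1) B by blast
    next
      case False
      then obtain c where c: "c \<in> B" "c \<notin> A" by blast
      then have "c \<in> topspace X"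
        using conv B by (auto simp: order_convex_in_def)
      \<comment> \<open>A point outside the convex set \<open>A\<close> lies between no two of its
        points, so all of \<open>A\<close> is on one side of it.\<close>
      then have "(\<forall>a\<in>A. c < a) \<or> (\<forall>a\<in>A. a < c)"
        using order_convex_inD[OF conv[OF A(1)]] c(2) by (metis linorder_neqE)
      then show ?thesis using B c(1) by blast
    qed
  qed
  moreover have "finite (insert A (?L \<union> ?R))"
    using finite_protruding[OF pf conv anti, of "(<)"] finite_protruding[OF pf conv anti, of "(>)"]
    by simp
  ultimately have "finite {B \<in> \<A>. B \<inter> A \<noteq> {}}"
    by (rule finite_subset)
  then show "\<exists>V. openin X V \<and> x \<in> V \<and> finite {U \<in> \<A>. U \<inter> V \<noteq> {}}"
    using A cover unfolding open_cover_def by blast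
qed

theorem theorem2p1:
  fixes X :: "'a::linorder topology"
  assumes "GO_space X" and "monotonically_metacompact X"
  shows "\<exists>r. monotone_open_locally_finite_operator X r"
proof -
  obtain r where r: "\<And>\<U>. open_cover X \<U> \<Longrightarrow>
        open_cover X (r \<U>) \<and> refines (r \<U>) \<U> \<and> point_finite_in X (r \<U>)"
    and mono: "monotone_cover_operator X r"
    using assms(2) unfolding monotonically_metacompact_def by blast
  define c where "c \<U> = convex_components (topspace X) (r \<U>)" for \<U>
  define s where "s \<U> = maximal_members (c \<U>)" for \<U>
  have c: "open_cover X (c \<U>)" "point_finite_in X (c \<U>)"
      "\<And>C. C \<in> c \<U> \<Longrightarrow> order_convex_in (topspace X) C" "refines (c \<U>) (s \<U>)"
    if "open_cover X \<U>" for \<U>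
  proof -
    have sub: "\<Union>(r \<U>) \<subseteq> topspace X"
      using r[OF that] by (simp add: open_cover_def)
    show cov: "open_cover X (c \<U>)"
      using r[OF that] open_cover_convex_components[OF assms(1)] by (simp add: c_def)
    show pf: "point_finite_in X (c \<U>)"
      using r[OF that] point_finite_convex_components[OF sub] by (simp add: c_def)
    show "order_convex_in (topspace X) C" if "C \<in> c \<U>" for C
      using convex_components_convex[OF sub] that by (simp add: c_def)
    have "{} \<notin> c \<U>"
      using convex_components_nonempty[of "{}"] by (auto simp: c_def)
    then show "refines (c \<U>) (s \<U>)"
      using refines_maximal_members[OF pf] cov unfolding s_def open_cover_def by simp
  qed
  have sc: "s \<U> \<subseteq> c \<U>" for \<U>
    unfolding s_def by (rule maximal_members_subset)
  have "open_cover X (s \<U>) \<and> refines (s \<U>) \<U> \<and> locally_finite_in X (s \<U>)"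
    if U: "open_cover X \<U>" for \<U>
  proof (intro conjI)
    \<comment> \<open>Being a subfamily gives one inclusion; the refinement of \<open>c \<U>\<close>
      into \<open>s \<U>\<close> gives the other.\<close>
    have "\<Union>(s \<U>) = \<Union>(c \<U>)"
      using sc[of \<U>] c(4)[OF U] unfolding refines_def by blast
    then show cov: "open_cover X (s \<U>)"
      using c(1)[OF U] sc[of \<U>] unfolding open_cover_def by (simp add: subset_eq)
    have "refines (s \<U>) (r \<U>)"
      by (rule refines_trans[OF refines_subset[OF sc[unfolded c_def]] refines_convex_components])
    then show "refines (s \<U>) \<U>"
      by (rule refines_trans) (use r[OF U] in simp)
    have pf: "point_finite_in X (s \<U>)"
      unfolding point_finite_in_def
    proof
      fix x assume "x \<in> topspace X"
      then have "finite {A \<in> c \<U>. x \<in> A}"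
        using c(2)[OF U] unfolding point_finite_in_def by blast
      then show "finite {A \<in> s \<U>. x \<in> A}"
        by (rule rev_finite_subset) (use sc in blast)
    qed
    show "locally_finite_in X (s \<U>)"
    proof (rule locally_finite_convex_antichain[OF cov pf])
      show "order_convex_in (topspace X) B" if "B \<in> s \<U>" for B
        using c(3)[OF U] sc that by blast
      show "B = C" if "B \<in> s \<U>" "C \<in> s \<U>" "B \<subseteq> C" for B C
        using that unfolding s_def maximal_members_def by blast
    qed
  qed
  moreover have "monotone_cover_operator X s"
    unfolding monotone_cover_operator_def
  proof (intro allI impI, elim conjE)
    fix \<U> \<V> assume UV: "open_cover X \<U>" "open_cover X \<V>" "refines \<U> \<V>"
    then have "refines (r \<U>) (r \<V>)"
      using mono by (simp add: monotone_cover_operator_def)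
    then have "refines (c \<U>) (c \<V>)"
      unfolding c_def by (rule convex_components_mono)
    \<comment> \<open>A member of \<open>c \<V>\<close> containing a given member of
      \<open>s \<U>\<close> may fail to be maximal; the last refinement enlarges it to a member of
      \<open>s \<V>\<close>.\<close>
    with refines_subset[OF sc] have "refines (s \<U>) (c \<V>)"
      by (rule refines_trans)
    then show "refines (s \<U>) (s \<V>)"
      using c(4)[OF UV(2)] by (rule refines_trans)
  qed
  ultimately show ?thesis
    unfolding monotone_open_locally_finite_operator_def by blast
qed

end
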